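(* Let $(X,\mathcal R)$ be a commutative association scheme with $s$ classes, let $n\geqslant 2$, fix $x_0\in X$, and let $C$ be a code in $X^n$. For every integer $r\geqslant 1$ let \[S_r=\{\alpha\in\mathbb N^s:\ r\leqslant|\alpha|\leqslant n-r,\ \mathbf E^*_\alpha\hat C\neq 0\}\subset\mathbb R^s,\] and let $\delta^*=\min\{i\neq 0:\ \mathbf E^{\mathrm H}_i\hat C\neq 0\}$. Suppose that an integer $t$ with $1\leqslant t\leqslant n$ satisfies $\mu(S_r)<\delta^*-r$ for all $1\leqslant r\leqslant t$. Then for every $\alpha\in\mathbb N^s$ with $|\alpha|\leqslant n$, the multiset $\{\operatorname{supp}(\mathbf x):\mathbf x\in (X^n)_\alpha\cap C\}$ is a $t$-design (with block size $|\alpha|$, possibly with repeated blocks).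
   Context: $(X,\mathcal R)$, $\mathcal R=\{R_0,\dots,R_s\}$, is a commutative association scheme with $s$ classes: $X$ is a finite set, the $R_i$ are nonempty binary relations on $X$, and their $0$-$1$ adjacency matrices $A_i$ (rows and columns indexed by $X$) satisfy $A_0=I$, $\sum_{i=0}^sA_i=J$ (all-ones matrix), each $A_i^{\mathsf T}$ is one of $A_0,\dots,A_s$, and $A_iA_j=A_jA_i\in M:=\operatorname{span}_{\mathbb C}\{A_0,\dots,A_s\}$. Let $V=\mathbb C^X$ with orthonormal basis $\{\hat x:x\in X\}$ and standard Hermitian inner product. Identify $\mathbb C^{X^n}$ with $V^{\otimes n}$ via $\hat{\mathbf x}=\hat x_1\otimes\cdots\otimes\hat x_n$ for $\mathbf x=(x_1,\dots,x_n)$, and for $C\subseteq X^n$ let $\hat C=\sum_{\mathbf x\in C}\hat{\mathbf x}$. $\mathbb N=\{0,1,2,\dots\}$; for $\alpha\in\mathbb N^s$, $|\alpha|=\sum_i\alpha_i$. Put $\mathbf x_0=(x_0,\dots,x_0)\in X^n$. For $\mathbf x,\mathbf y\in X^n$ the composition $c(\mathbf x,\mathbf y)\in\mathbb N^s$ has $i$-th entry $|\{\ell:(x_\ell,y_\ell)\in R_i\}|$ ($1\le i\le s$). For $|\alpha|\le n$, $(X^n)_\alpha=\{\mathbf x\in X^n:c(\mathbf x_0,\mathbf x)=\alpha\}$ and $\mathbf E^*_\alpha$ is the diagonal matrix projecting orthogonally onto $\operatorname{span}\{\hat{\mathbf x}:\mathbf x\in(X^n)_\alpha\}$. Let $F_0=|X|^{-1}J$,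 $F_1=I-F_0$ on $V$, and for $0\le i\le n$ let $\mathbf E^{\mathrm H}_i=\sum_{\tau\in\{0,1\}^n,\ \sum_\ell\tau_\ell=i}F_{\tau_1}\otimes\cdots\otimes F_{\tau_n}$ (the primitive idempotents of the Hamming scheme $H(n,|X|)$). A code in $X^n$ is a subset $C$ with $1<|C|<|X|^n$. The support of $\mathbf x$ is $\operatorname{supp}(\mathbf x)=\{\ell:x_\ell\neq x_0\}\subseteq\{1,\dots,n\}$. A multiset $\mathcal B$ of $k$-subsets of $\{1,\dots,n\}$ is a $t$-design if the number of members of $\mathcal B$ (counted with multiplicity) containing a $t$-subset $T$ of $\{1,\dots,n\}$ is independent of $T$. Interpolation: for a finite $S\subset\mathbb R^s$, a linear subspace $\mathscr L\subseteq\mathbb R[\xi_1,\dots,\xi_s]$ is an interpolation space w.r.t. $S$ if for every polynomial $f$ there is a unique $g\in\mathscr L$ with $f(z)=g(z)$ for all $z\in S$; it is a minimal degree interpolation space if moreover this $g$ always satisfies $\deg g\le\deg f$. Such spaces exist, and $\mu(S)$ denotes the maximum degree of an element of a minimal degree interpolation space w.r.t. $S$ (independent of the choice). *)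

theory Defs
  imports
    "HOL-Analysis.Analysis"
    "HOL-Library.Multiset"
    "HOL-Library.Poly_Mapping"
begin

text \<open>
  The finite set \<open>X\<close> is the universe of a finite type \<open>'x\<close>, the set of coordinate positions
  \<open>{1..n}\<close> is the universe of a finite type \<open>'n\<close> with \<open>n = CARD('n)\<close>, and \<open>X\<^sup>n\<close> is \<open>'x ^ 'n\<close>.
  Operators on \<open>V\<close> and on its \<open>n\<close>-th tensor power are complex matrices indexed by \<open>'x\<close>
  and \<open>'x ^ 'n\<close>, the standard orthonormal basis of the tensor power being indexed by words.
\<close>

section \<open>Commutative association schemes\<close>

definition cscale :: "complex \<Rightarrow> complex ^ 'm ^ 'k \<Rightarrow> complex ^ 'm ^ 'k" where
  "cscale c A = (\<chi> i j. c * A $ i $ j)"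

interpretation cmat: vector_space "cscale :: complex \<Rightarrow> complex ^ 'm ^ 'k \<Rightarrow> complex ^ 'm ^ 'k"
  by unfold_locales (simp_all add: cscale_def vec_eq_iff algebra_simps)

definition adj_mat :: "('x \<times> 'x) set \<Rightarrow> complex ^ 'x ^ 'x" where
  "adj_mat R = (\<chi> x y. if (x, y) \<in> R then 1 else 0)"

definition all_ones :: "complex ^ 'x ^ 'x" where
  "all_ones = (\<chi> x y. 1)"

definition comm_assoc_scheme :: "nat \<Rightarrow> (nat \<Rightarrow> ('x::finite \<times> 'x) set) \<Rightarrow> bool" where
  "comm_assoc_scheme s R \<longleftrightarrow>
     (\<forall>i\<le>s. R i \<noteq> {}) \<and>
     adj_mat (R 0) = mat 1 \<and>
     (\<Sum>i\<le>s. adj_mat (R i)) = all_ones \<and>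
     (\<forall>i\<le>s. \<exists>j\<le>s. transpose (adj_mat (R i)) = adj_mat (R j)) \<and>
     (\<forall>i\<le>s. \<forall>j\<le>s.
        adj_mat (R i) ** adj_mat (R j) = adj_mat (R j) ** adj_mat (R i) \<and>
        adj_mat (R i) ** adj_mat (R j) \<in> cmat.span ((\<lambda>k. adj_mat (R k)) ` {..s}))"

section \<open>Compositions, supports and idempotents\<close>

text \<open>Elements of \<open>\<nat>\<^sup>s\<close> are functions vanishing outside \<open>{1..s}\<close>.\<close>

definition multi_indices :: "nat \<Rightarrow> (nat \<Rightarrow> nat) set" where
  "multi_indices s = {\<alpha>. \<forall>i. i \<notin> {1..s} \<longrightarrow> \<alpha> i = 0}"

definition weight :: "nat \<Rightarrow> (nat \<Rightarrow> nat) \<Rightarrow> nat" where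
  "weight s \<alpha> = (\<Sum>i=1..s. \<alpha> i)"

definition composition ::
  "nat \<Rightarrow> (nat \<Rightarrow> ('x \<times> 'x) set) \<Rightarrow> 'x ^ 'n::finite \<Rightarrow> 'x ^ 'n \<Rightarrow> nat \<Rightarrow> nat" where
  "composition s R x y i = (if i \<in> {1..s} then card {l. (x $ l, y $ l) \<in> R i} else 0)"

definition words_of_comp ::
  "nat \<Rightarrow> (nat \<Rightarrow> ('x \<times> 'x) set) \<Rightarrow> 'x \<Rightarrow> (nat \<Rightarrow> nat) \<Rightarrow> ('x ^ 'n::finite) set" where
  "words_of_comp s R x0 \<alpha> = {x. composition s R (\<chi> l. x0) x = \<alpha>}"

definition char_vec :: "('x::finite ^ 'n::finite) set \<Rightarrow> complex ^ ('x ^ 'n)" where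
  "char_vec C = (\<Sum>x\<in>C. axis x 1)"

definition dual_idem ::
  "nat \<Rightarrow> (nat \<Rightarrow> ('x::finite \<times> 'x) set) \<Rightarrow> 'x \<Rightarrow> (nat \<Rightarrow> nat)
     \<Rightarrow> complex ^ ('x ^ 'n::finite) ^ ('x ^ 'n)" where
  "dual_idem s R x0 \<alpha> = (\<chi> x y. if x = y \<and> x \<in> words_of_comp s R x0 \<alpha> then 1 else 0)"

text \<open>The matrix of a tensor product of operators, one for each coordinate position.\<close>

definition tensor_mat ::
  "('n::finite \<Rightarrow> complex ^ 'x::finite ^ 'x) \<Rightarrow> complex ^ ('x ^ 'n) ^ ('x ^ 'n)" where
  "tensor_mat F = (\<chi> x y. \<Prod>l\<in>UNIV. F l $ (x $ l) $ (y $ l))"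

definition base_idem :: "nat \<Rightarrow> complex ^ 'x ^ 'x::finite" where
  "base_idem k = (let F0 = cscale (1 / of_nat CARD('x)) all_ones
                  in if k = 0 then F0 else mat 1 - F0)"

definition hamming_idem :: "nat \<Rightarrow> complex ^ ('x::finite ^ 'n::finite) ^ ('x ^ 'n)" where
  "hamming_idem i =
     (\<Sum>\<tau> \<in> {\<tau> :: 'n \<Rightarrow> nat. (\<forall>l. \<tau> l \<in> {0, 1}) \<and> (\<Sum>l\<in>UNIV. \<tau> l) = i}.
        tensor_mat (\<lambda>l. base_idem (\<tau> l)))"

definition is_code :: "('x::finite ^ 'n::finite) set \<Rightarrow> bool" where
  "is_code C \<longleftrightarrow> 1 < card C \<and> card C < CARD('x) ^ CARD('n)"

text \<open>For a code the set below is nonempty: otherwise \<open>char_vec C\<close> would be a multiple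
  of the all-ones vector.\<close>

definition dual_distance :: "('x::finite ^ 'n::finite) set \<Rightarrow> nat" where
  "dual_distance C = Min {i \<in> {1..CARD('n)}. hamming_idem i *v char_vec C \<noteq> 0}"

definition supp :: "'x \<Rightarrow> 'x ^ 'n \<Rightarrow> 'n set" where
  "supp x0 x = {l. x $ l \<noteq> x0}"

definition is_design :: "nat \<Rightarrow> nat \<Rightarrow> 'n::finite set multiset \<Rightarrow> bool" where
  "is_design t k B \<longleftrightarrow>
     (\<forall>b\<in>#B. card b = k) \<and>
     (\<exists>m. \<forall>T :: 'n set. card T = t \<longrightarrow> size {#b \<in># B. T \<subseteq> b#} = m)"

section \<open>Polynomial interpolation\<close>

text \<open>
  A polynomial is a finitely supported map from monomials to coefficients, and a monomial
  is a finitely supported map from indices of variables to exponents.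
\<close>

type_synonym rpoly = "(nat \<Rightarrow>\<^sub>0 nat) \<Rightarrow>\<^sub>0 real"

definition polys :: "nat \<Rightarrow> rpoly set" where
  "polys s = {p. \<forall>m \<in> Poly_Mapping.keys p. Poly_Mapping.keys m \<subseteq> {1..s}}"

definition eval_poly :: "rpoly \<Rightarrow> (nat \<Rightarrow> real) \<Rightarrow> real" where
  "eval_poly p z =
     (\<Sum>m \<in> Poly_Mapping.keys p. Poly_Mapping.lookup p m *
        (\<Prod>i \<in> Poly_Mapping.keys m. z i ^ Poly_Mapping.lookup m i))"

definition scale_poly :: "real \<Rightarrow> rpoly \<Rightarrow> rpoly" where
  "scale_poly c p = Poly_Mapping.single 0 c * p"

interpretation rpoly: vector_space scale_poly
  by unfold_locales
    (simp_all add: scale_poly_def algebra_simps single_add mult_single flip: mult.assoc)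

definition mono_deg :: "(nat \<Rightarrow>\<^sub>0 nat) \<Rightarrow> nat" where
  "mono_deg m = (\<Sum>i \<in> Poly_Mapping.keys m. Poly_Mapping.lookup m i)"

text \<open>The total degree; the zero polynomial has degree \<open>-\<infinity>\<close>.\<close>

definition poly_deg :: "rpoly \<Rightarrow> ereal" where
  "poly_deg p =
     (if p = 0 then -\<infinity> else ereal (real (Max (mono_deg ` Poly_Mapping.keys p))))"

definition interp_space :: "nat \<Rightarrow> (nat \<Rightarrow> real) set \<Rightarrow> rpoly set \<Rightarrow> bool" where
  "interp_space s S L \<longleftrightarrow>
     L \<subseteq> polys s \<and> rpoly.subspace L \<and>
     (\<forall>f\<in>polys s. \<exists>!g. g \<in> L \<and> (\<forall>z\<in>S. eval_poly f z = eval_poly g z))"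

definition min_deg_interp_space :: "nat \<Rightarrow> (nat \<Rightarrow> real) set \<Rightarrow> rpoly set \<Rightarrow> bool" where
  "min_deg_interp_space s S L \<longleftrightarrow>
     interp_space s S L \<and>
     (\<forall>f\<in>polys s. \<forall>g\<in>L. (\<forall>z\<in>S. eval_poly f z = eval_poly g z) \<longrightarrow> poly_deg g \<le> poly_deg f)"

text \<open>
  For finite \<open>S\<close> a minimal degree interpolation space exists, has finite dimension, and the
  maximum degree of its elements does not depend on the choice.  If \<open>S\<close> is empty, the only
  such space is \<open>{0}\<close> and \<open>interp_deg s S = -\<infinity>\<close>.
\<close>

definition interp_deg :: "nat \<Rightarrow> (nat \<Rightarrow> real) set \<Rightarrow> ereal" where
  "interp_deg s S = Max (poly_deg ` (SOME L. min_deg_interp_space s S L))"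

definition comp_set ::
  "nat \<Rightarrow> (nat \<Rightarrow> ('x::finite \<times> 'x) set) \<Rightarrow> 'x \<Rightarrow> ('x ^ 'n::finite) set \<Rightarrow> nat
     \<Rightarrow> (nat \<Rightarrow> real) set" where
  "comp_set s R x0 C r =
     (\<lambda>\<alpha> i. real (\<alpha> i)) `
       {\<alpha> \<in> multi_indices s. r \<le> weight s \<alpha> \<and> weight s \<alpha> + r \<le> CARD('n) \<and>
          dual_idem s R x0 \<alpha> *v char_vec C \<noteq> 0}"

end

theory Submission
  imports Defs
begin

text \<open>
  For disjoint pairs \<open>(a\<^sub>1, b\<^sub>1), \<dots>, (a\<^sub>r, b\<^sub>r)\<close> of coordinates, the sign function
  \<open>\<Prod>\<^sub>i ([a\<^sub>i \<in> B] - [b\<^sub>i \<in> B])\<close> of a set \<open>B\<close> is harmonic of degree \<open>r\<close>.  It vanishes unless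
  \<open>r \<le> |B| \<le> n - r\<close>, and exchanging \<open>a\<^sub>1\<close> and \<open>b\<^sub>1\<close> shows that its product with any function of
  the composition sums to \<open>0\<close> over \<open>X\<^sup>n\<close>.  A code with dual distance \<open>\<delta>\<close> is an orthogonal array
  of strength \<open>\<delta> - 1\<close>, so that product also sums to \<open>0\<close> over \<open>C\<close> if the function is a polynomial
  of degree less than \<open>\<delta> - r\<close>.  By interpolation such a polynomial can be chosen as the indicator of
  one composition on \<open>S\<^sub>r\<close>, so the sign functions with \<open>1 \<le> r \<le> t\<close> sum to \<open>0\<close> over the supports of
  the codewords of that composition, and this forces a \<open>t\<close>-design.
\<close>

section \<open>Evaluation and degree of polynomials\<close>

definition eval_mono :: "(nat \<Rightarrow>\<^sub>0 nat) \<Rightarrow> (nat \<Rightarrow> real) \<Rightarrow> real" where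
  "eval_mono m z = (\<Prod>i \<in> Poly_Mapping.keys m. z i ^ Poly_Mapping.lookup m i)"

lemma eval_poly_alt:
  "eval_poly p z = (\<Sum>m \<in> Poly_Mapping.keys p. Poly_Mapping.lookup p m * eval_mono m z)"
  by (simp add: eval_poly_def eval_mono_def)

lemma eval_mono_superset:
  assumes "finite A" "Poly_Mapping.keys m \<subseteq> A"
  shows "eval_mono m z = (\<Prod>i\<in>A. z i ^ Poly_Mapping.lookup m i)"
  unfolding eval_mono_def
  by (rule prod.mono_neutral_left) (use assms in \<open>auto simp: in_keys_iff\<close>)

lemma eval_mono_0 [simp]: "eval_mono 0 z = 1"
  by (simp add: eval_mono_def)

lemma eval_mono_single [simp]: "eval_mono (Poly_Mapping.single i (Suc 0)) z = z i"
  by (simp add: eval_mono_def)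

lemma eval_mono_add: "eval_mono (m + m') z = eval_mono m z * eval_mono m' z"
proof -
  let ?A = "Poly_Mapping.keys m \<union> Poly_Mapping.keys m'"
  have "Poly_Mapping.keys (m + m') \<subseteq> ?A"
    by (rule Poly_Mapping.keys_add)
  then show ?thesis
    by (simp add: eval_mono_superset[of ?A] lookup_add power_add prod.distrib)
qed

lemma eval_poly_superset:
  assumes "finite A" "Poly_Mapping.keys p \<subseteq> A"
  shows "eval_poly p z = (\<Sum>m\<in>A. Poly_Mapping.lookup p m * eval_mono m z)"
  unfolding eval_poly_alt
  by (rule sum.mono_neutral_left) (use assms in \<open>auto simp: in_keys_iff\<close>)

lemma eval_poly_0 [simp]: "eval_poly 0 z = 0"
  by (simp add: eval_poly_alt)

lemma eval_poly_single [simp]: "eval_poly (Poly_Mapping.single m c) z = c * eval_mono m z"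
  by (simp add: eval_poly_alt)

lemma eval_poly_one [simp]: "eval_poly 1 z = 1"
  by (simp flip: single_one)

lemma eval_poly_add: "eval_poly (p + q) z = eval_poly p z + eval_poly q z"
proof -
  let ?A = "Poly_Mapping.keys p \<union> Poly_Mapping.keys q"
  have "Poly_Mapping.keys (p + q) \<subseteq> ?A"
    by (rule Poly_Mapping.keys_add)
  then show ?thesis
    by (simp add: eval_poly_superset[of ?A] lookup_add algebra_simps sum.distrib)
qed

lemma eval_poly_diff: "eval_poly (p - q) z = eval_poly p z - eval_poly q z"
  using eval_poly_add[of "p - q" q z] by simp

lemma eval_poly_sum: "eval_poly (\<Sum>i\<in>I. f i) z = (\<Sum>i\<in>I. eval_poly (f i) z)"
  by (induction I rule: infinite_finite_induct) (auto simp: eval_poly_add)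

lemma poly_mapping_eq_sum_single:
  "p = (\<Sum>m\<in>Poly_Mapping.keys p. Poly_Mapping.single m (Poly_Mapping.lookup p m))"
  by (rule poly_mapping_eqI)
     (auto simp: lookup_sum lookup_single when_def in_keys_iff)

lemma eval_poly_mult: "eval_poly (p * q) z = eval_poly p z * eval_poly q z"
proof -
  have "p * q = (\<Sum>m\<in>Poly_Mapping.keys p. \<Sum>m'\<in>Poly_Mapping.keys q.
      Poly_Mapping.single (m + m') (Poly_Mapping.lookup p m * Poly_Mapping.lookup q m'))"
    by (subst (1) poly_mapping_eq_sum_single[of p], subst (1) poly_mapping_eq_sum_single[of q])
       (simp add: sum_product mult_single)
  then have "eval_poly (p * q) z = (\<Sum>m\<in>Poly_Mapping.keys p. \<Sum>m'\<in>Poly_Mapping.keys q.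
      (Poly_Mapping.lookup p m * eval_mono m z) * (Poly_Mapping.lookup q m' * eval_mono m' z))"
    by (simp add: eval_poly_sum eval_mono_add mult_ac)
  then show ?thesis
    by (simp add: eval_poly_alt sum_product)
qed

lemma eval_poly_prod: "eval_poly (\<Prod>i\<in>I. f i) z = (\<Prod>i\<in>I. eval_poly (f i) z)"
  by (induction I rule: infinite_finite_induct) (auto simp: eval_poly_mult)

lemma eval_poly_scale: "eval_poly (scale_poly c p) z = c * eval_poly p z"
  by (simp add: scale_poly_def eval_poly_mult)

lemma polys_mult:
  assumes "p \<in> polys s" "q \<in> polys s"
  shows "p * q \<in> polys s"
  unfolding polys_def
proof (rule CollectI, rule ballI)
  fix m assume "m \<in> Poly_Mapping.keys (p * q)"
  then obtain a b where "m = a + b" "a \<in> Poly_Mapping.keys p" "b \<in> Poly_Mapping.keys q"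
    using keys_mult[of p q] by blast
  with assms Poly_Mapping.keys_add[of a b] show "Poly_Mapping.keys m \<subseteq> {1..s}"
    unfolding polys_def by blast
qed

lemma polys_single: "Poly_Mapping.keys m \<subseteq> {1..s} \<Longrightarrow> Poly_Mapping.single m c \<in> polys s"
  by (simp add: polys_def)

lemma subspace_polys: "rpoly.subspace (polys s)"
proof (rule rpoly.subspaceI)
  fix p q assume "p \<in> polys s" "q \<in> polys s"
  then show "p + q \<in> polys s"
    using Poly_Mapping.keys_add[of p q] unfolding polys_def by blast
next
  fix c p assume "p \<in> polys s"
  then show "scale_poly c p \<in> polys s"
    unfolding scale_poly_def by (intro polys_mult polys_single) simp_all
qed (simp add: polys_def)

lemma polys_prod:
  assumes "\<And>i. i \<in> I \<Longrightarrow> f i \<in> polys s"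
  shows "(\<Prod>i\<in>I. f i) \<in> polys s"
  using assms
proof (induction I rule: infinite_finite_induct)
  case (insert x F)
  then show ?case
    by (simp add: polys_mult)
qed (simp_all add: polys_single flip: single_one)

section \<open>Total degree of sums, differences and multiples\<close>

lemma poly_deg_le_iff:
  "poly_deg p \<le> e \<longleftrightarrow> (\<forall>m\<in>Poly_Mapping.keys p. ereal (real (mono_deg m)) \<le> e)"
proof (cases "p = 0")
  case False
  let ?M = "mono_deg ` Poly_Mapping.keys p"
  have fin: "finite ?M" "?M \<noteq> {}"
    using False by auto
  have "poly_deg p = ereal (real (Max ?M))"
    using False by (simp add: poly_deg_def)
  moreover have "ereal (real m) \<le> ereal (real (Max ?M))" if "m \<in> ?M" for m
    using Max_ge[OF fin(1) that] by simp
  moreover have "Max ?M \<in> ?M"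
    using fin by (rule Max_in)
  ultimately show ?thesis
    by (metis (no_types, lifting) imageE imageI order_trans)
qed (simp add: poly_deg_def)

lemma poly_deg_nonzero: "p \<noteq> 0 \<Longrightarrow> \<exists>d::nat. poly_deg p = ereal (real d)"
  by (auto simp: poly_deg_def)

lemma poly_deg_add_le:
  assumes "poly_deg p \<le> e" "poly_deg q \<le> e"
  shows "poly_deg (p + q) \<le> e"
  using assms Poly_Mapping.keys_add[of p q] unfolding poly_deg_le_iff by blast

lemma poly_deg_scale_le:
  assumes "poly_deg p \<le> e"
  shows "poly_deg (scale_poly c p) \<le> e"
proof -
  have "Poly_Mapping.keys (scale_poly c p) \<subseteq> Poly_Mapping.keys p"
    using keys_mult[of "Poly_Mapping.single 0 c" p]
    by (auto simp: scale_poly_def split: if_splits)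
  with assms show ?thesis
    unfolding poly_deg_le_iff by blast
qed

lemma poly_deg_diff_le:
  assumes "poly_deg p \<le> e" "poly_deg q \<le> e"
  shows "poly_deg (p - q) \<le> e"
proof -
  have "p - q = p + scale_poly (- 1) q"
    by (simp add: scale_poly_def single_uminus)
  then show ?thesis
    using poly_deg_add_le[OF assms(1) poly_deg_scale_le[OF assms(2)]] by metis
qed

section \<open>Minimal degree interpolation\<close>

lemma min_deg_interp_space_le:
  assumes "min_deg_interp_space s S L" "f \<in> polys s" "g \<in> L"
    and "\<And>z. z \<in> S \<Longrightarrow> eval_poly g z = eval_poly f z"
  shows "poly_deg g \<le> poly_deg f"
proof -
  have "\<forall>z\<in>S. eval_poly f z = eval_poly g z"
    using assms(4) by metis
  with assms(1-3) show ?thesis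
    unfolding min_deg_interp_space_def by blast
qed

lemma interp_space_obtain:
  assumes "interp_space s S L" "f \<in> polys s"
  obtains g where "g \<in> L" "\<And>z. z \<in> S \<Longrightarrow> eval_poly g z = eval_poly f z"
proof -
  from assms obtain g where "g \<in> L \<and> (\<forall>z\<in>S. eval_poly f z = eval_poly g z)"
    unfolding interp_space_def by (meson ex1_implies_ex)
  then show thesis
    using that by metis
qed

lemma interp_space_unique:
  assumes "interp_space s S L" "g \<in> L" "g' \<in> L"
    and "\<And>z. z \<in> S \<Longrightarrow> eval_poly g z = eval_poly g' z"
  shows "g = g'"
proof -
  have "g \<in> polys s"
    using assms unfolding interp_space_def by blast
  then have "\<exists>!h. h \<in> L \<and> (\<forall>z\<in>S. eval_poly g z = eval_poly h z)"
    using assms(1) unfolding interp_space_def by blast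
  then show ?thesis
    using assms(2-4) by auto
qed

text \<open>Since \<open>L\<close> is a subspace, uniqueness of interpolants reduces to a trivial
  kernel. The degree bound then has to be found for one interpolant only, because no other lies in
  \<open>L\<close>.\<close>

lemma min_deg_interp_spaceI:
  assumes "L \<subseteq> polys s" "rpoly.subspace L"
    and inj: "\<And>g. g \<in> L \<Longrightarrow> (\<And>z. z \<in> S \<Longrightarrow> eval_poly g z = 0) \<Longrightarrow> g = 0"
    and ex: "\<And>f. f \<in> polys s \<Longrightarrow>
      \<exists>g\<in>L. (\<forall>z\<in>S. eval_poly f z = eval_poly g z) \<and> poly_deg g \<le> poly_deg f"
  shows "min_deg_interp_space s S L"
proof -
  have uniq: "g = g'" if "g \<in> L" "g' \<in> L" "\<forall>z\<in>S. eval_poly g z = eval_poly g' z" for g g'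
    using inj[of "g - g'"] that assms(2) by (simp add: rpoly.subspace_diff eval_poly_diff)
  show ?thesis
    unfolding min_deg_interp_space_def interp_space_def
  proof (intro conjI assms(1,2) ballI impI)
    fix f assume "f \<in> polys s"
    with ex obtain g where "g \<in> L" "\<forall>z\<in>S. eval_poly f z = eval_poly g z"
      by blast
    with uniq show "\<exists>!g. g \<in> L \<and> (\<forall>z\<in>S. eval_poly f z = eval_poly g z)"
      by metis
  next
    fix f g assume f: "f \<in> polys s" "g \<in> L" "\<forall>z\<in>S. eval_poly f z = eval_poly g z"
    with ex obtain g' where "g' \<in> L" "\<forall>z\<in>S. eval_poly f z = eval_poly g' z"
      "poly_deg g' \<le> poly_deg f"
      by blast
    moreover from this f have "g = g'"
      by (intro uniq) metis+
    ultimately show "poly_deg g \<le> poly_deg f"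
      by simp
  qed
qed

text \<open>Newton interpolation: the new basis element for an additional point \<open>z\<close> is a polynomial
  of least possible degree that vanishes at the old points but not at \<open>z\<close>.\<close>

lemma min_deg_interp_space_exists:
  assumes "finite S"
  shows "\<exists>L. min_deg_interp_space s S L \<and> (\<exists>b::nat. \<forall>g\<in>L. poly_deg g \<le> ereal (real b))"
  using assms
proof (induction S)
  case empty
  have "min_deg_interp_space s {} {0}"
  proof (rule min_deg_interp_spaceI)
    show "{0} \<subseteq> polys s"
      by (simp add: polys_def)
    show "rpoly.subspace {0}"
      by (rule rpoly.subspace_single_0)
  qed (simp_all add: poly_deg_def)
  moreover have "poly_deg 0 \<le> ereal (real 0)"
    by (simp add: poly_deg_def)
  ultimately show ?case
    by blast
next
  case (insert z S)
  then obtain L b where L: "min_deg_interp_space s S L"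
    and b: "\<And>g. g \<in> L \<Longrightarrow> poly_deg g \<le> ereal (real b)"
    by blast
  have Lint: "interp_space s S L" and Lsub: "rpoly.subspace L" and Lpol: "L \<subseteq> polys s"
    using L by (auto simp: min_deg_interp_space_def interp_space_def)
  define H where "H = {h \<in> polys s. (\<forall>y\<in>S. eval_poly h y = 0) \<and> eval_poly h z \<noteq> 0}"
  have zero: "g = 0" if "g \<in> L" "\<And>y. y \<in> S \<Longrightarrow> eval_poly g y = 0" for g
    using interp_space_unique[OF Lint, of g 0] that Lsub by (simp add: rpoly.subspace_0)
  have interp: "\<exists>g\<in>L. (\<forall>y\<in>S. eval_poly g y = eval_poly f y) \<and> poly_deg g \<le> poly_deg f
      \<and> f - g \<in> polys s \<and> (\<forall>y\<in>S. eval_poly (f - g) y = 0)" if f: "f \<in> polys s" for f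
  proof -
    obtain g where g: "g \<in> L" "\<And>y. y \<in> S \<Longrightarrow> eval_poly g y = eval_poly f y"
      using interp_space_obtain[OF Lint f] by blast
    then have "poly_deg g \<le> poly_deg f"
      using min_deg_interp_space_le[OF L f] by blast
    then show ?thesis
      using g f Lpol rpoly.subspace_diff[OF subspace_polys, of f s g]
      by (auto simp: eval_poly_diff intro!: bexI[of _ g])
  qed
  show ?case
  proof (cases "H = {}")
    \<comment> \<open>Every polynomial vanishing on \<open>S\<close> vanishes at \<open>z\<close>
      too, as happens when \<open>z\<close> agrees with an old point on the coordinates 1..s. The
      old space then already interpolates at \<open>z\<close>.\<close>
    case True
    have "min_deg_interp_space s (insert z S) L"
    proof (rule min_deg_interp_spaceI[OF Lpol Lsub])
      fix f assume "f \<in> polys s"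
      from interp[OF this] obtain g where g: "g \<in> L" "\<forall>y\<in>S. eval_poly g y = eval_poly f y"
        "poly_deg g \<le> poly_deg f" "f - g \<in> polys s" "\<forall>y\<in>S. eval_poly (f - g) y = 0"
        by blast
      then have "eval_poly (f - g) z = 0"
        using True unfolding H_def by blast
      with g show "\<exists>g\<in>L. (\<forall>z\<in>insert z S. eval_poly f z = eval_poly g z) \<and> poly_deg g \<le> poly_deg f"
        by (intro bexI[of _ g]) (auto simp: eval_poly_diff)
    qed (use zero in blast)
    with b show ?thesis
      by blast
  next
    case False
    \<comment> \<open>The degree as a natural number, so that a least one exists. Members of
      \<open>H\<close> are nonzero, so this loses nothing for them.\<close>
    define natdeg where "natdeg h = nat \<lfloor>real_of_ereal (poly_deg h)\<rfloor>" for h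
    have natdeg: "poly_deg h = ereal (real (natdeg h))" if "h \<in> H" for h
    proof -
      have "h \<noteq> 0"
        using that by (auto simp: H_def)
      then show ?thesis
        using poly_deg_nonzero[of h] by (auto simp: natdeg_def)
    qed
    obtain h where h: "h \<in> H" and h_least: "\<And>k. k \<in> H \<Longrightarrow> natdeg h \<le> natdeg k"
      using False ex_has_least_nat[of "\<lambda>h. h \<in> H" _ natdeg] by blast
    have h_min: "poly_deg h \<le> poly_deg k" if "k \<in> H" for k
      using h_least[OF that] by (simp add: natdeg h that)
    define L' where "L' = {g + scale_poly c h |g c. g \<in> L}"
    have hz: "eval_poly h z \<noteq> 0" "\<And>y. y \<in> S \<Longrightarrow> eval_poly h y = 0" "h \<in> polys s"
      using h by (auto simp: H_def)
    have L'sub: "rpoly.subspace L'"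
    proof (rule rpoly.subspaceI)
      show "0 \<in> L'"
        unfolding L'_def using rpoly.subspace_0[OF Lsub]
        by (intro CollectI exI[of _ 0]) simp
    next
      fix p q assume "p \<in> L'" "q \<in> L'"
      then obtain g c g' c' where "p = g + scale_poly c h" "g \<in> L"
        "q = g' + scale_poly c' h" "g' \<in> L"
        by (auto simp: L'_def)
      then have "p + q = (g + g') + scale_poly (c + c') h" "g + g' \<in> L"
        using Lsub by (simp_all add: rpoly.subspace_add algebra_simps)
      then show "p + q \<in> L'"
        unfolding L'_def by blast
    next
      fix c p assume "p \<in> L'"
      then obtain g d where "p = g + scale_poly d h" "g \<in> L"
        by (auto simp: L'_def)
      then have "scale_poly c p = scale_poly c g + scale_poly (c * d) h" "scale_poly c g \<in> L"
        using Lsub by (simp_all add: rpoly.subspace_scale rpoly.scale_right_distrib)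
      then show "scale_poly c p \<in> L'"
        unfolding L'_def by blast
    qed
    have "min_deg_interp_space s (insert z S) L'"
    proof (rule min_deg_interp_spaceI[OF _ L'sub])
      show "L' \<subseteq> polys s"
        using Lpol hz(3) subspace_polys[of s]
        by (auto simp: L'_def intro!: rpoly.subspace_add rpoly.subspace_scale)
    next
      fix p assume "p \<in> L'" and p: "\<And>y. y \<in> insert z S \<Longrightarrow> eval_poly p y = 0"
      then obtain g c where g: "p = g + scale_poly c h" "g \<in> L"
        by (auto simp: L'_def)
      have "eval_poly g y = 0" if "y \<in> S" for y
        using p[of y] that hz(2) by (simp add: g(1) eval_poly_add eval_poly_scale)
      then have "g = 0"
        using zero g(2) by blast
      then have "c = 0"
        using p[of z] hz(1) by (simp add: g(1) eval_poly_add eval_poly_scale)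
      with \<open>g = 0\<close> show "p = 0"
        by (simp add: g(1))
    next
      fix f assume f: "f \<in> polys s"
      from interp[OF this] obtain g where g: "g \<in> L" "\<forall>y\<in>S. eval_poly g y = eval_poly f y"
        "poly_deg g \<le> poly_deg f" "f - g \<in> polys s" "\<forall>y\<in>S. eval_poly (f - g) y = 0"
        by blast
      \<comment> \<open>The coefficient that corrects the value at \<open>z\<close>. If it is
        nonzero, \<open>f - g\<close> is itself a candidate in \<open>H\<close>, so minimality gives
        deg h \<le> deg (f - g) \<le> deg f.\<close>
      define c where "c = eval_poly (f - g) z / eval_poly h z"
      have "poly_deg (g + scale_poly c h) \<le> poly_deg f"
      proof (cases "c = 0")
        case False
        then have "f - g \<in> H"
          using g by (auto simp: H_def c_def)
        then have "poly_deg h \<le> poly_deg f"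
          using h_min poly_deg_diff_le[of f "poly_deg f" g] g(3) order_trans by blast
        then show ?thesis
          by (intro poly_deg_add_le poly_deg_scale_le g(3))
      qed (simp add: g(3))
      moreover have "g + scale_poly c h \<in> L'"
        using g(1) by (auto simp: L'_def)
      moreover have "\<forall>y\<in>insert z S. eval_poly f y = eval_poly (g + scale_poly c h) y"
        using g(2) hz by (auto simp: eval_poly_add eval_poly_scale c_def eval_poly_diff)
      ultimately show "\<exists>g\<in>L'. (\<forall>z\<in>insert z S. eval_poly f z = eval_poly g z) \<and> poly_deg g \<le> poly_deg f"
        by blast
    qed
    \<comment> \<open>The uniform bound is carried along because \<open>interp_deg\<close> takes a
      \<open>Max\<close>, which calls for finitely many degrees.\<close>
    moreover have "poly_deg p \<le> ereal (real (max b (natdeg h)))" if p: "p \<in> L'" for p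
    proof -
      obtain g c where g: "p = g + scale_poly c h" "g \<in> L"
        using p by (auto simp: L'_def)
      have "poly_deg g \<le> ereal (real (max b (natdeg h)))"
        by (rule order_trans[OF b[OF g(2)]]) simp
      moreover have "poly_deg h \<le> ereal (real (max b (natdeg h)))"
        by (simp add: natdeg[OF h])
      ultimately show ?thesis
        unfolding g(1) by (intro poly_deg_add_le poly_deg_scale_le)
    qed
    ultimately show ?thesis
      by blast
  qed
qed

text \<open>\<open>interp_deg\<close> uses a space chosen by \<open>SOME\<close>, so the degree
  bound known for one space \<open>L0\<close> must be transferred to it. An element of
  \<open>L\<close> is the \<open>L\<close>-interpolant of its own interpolant in \<open>L0\<close>,
  hence its degree does not exceed that of the latter.\<close>

lemma interpolation_interp_deg:
  assumes "finite S" "f \<in> polys s"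
  obtains g where "g \<in> polys s" "\<And>z. z \<in> S \<Longrightarrow> eval_poly g z = eval_poly f z"
    "poly_deg g \<le> interp_deg s S"
proof -
  obtain L0 and b :: nat where L0: "min_deg_interp_space s S L0"
    and b: "\<And>g. g \<in> L0 \<Longrightarrow> poly_deg g \<le> ereal (real b)"
    using min_deg_interp_space_exists[OF assms(1)] by blast
  define L where "L = (SOME L. min_deg_interp_space s S L)"
  have L: "min_deg_interp_space s S L"
    unfolding L_def using L0 by (rule someI)
  then have Lint: "interp_space s S L" and Lpol: "L \<subseteq> polys s"
    by (auto simp: min_deg_interp_space_def interp_space_def)
  have "poly_deg g \<le> ereal (real b)" if g: "g \<in> L" for g
  proof -
    have L0': "interp_space s S L0" "L0 \<subseteq> polys s"
      using L0 by (auto simp: min_deg_interp_space_def interp_space_def)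
    have "g \<in> polys s"
      using g Lpol by blast
    from interp_space_obtain[OF L0'(1) this]
    obtain g0 where g0: "g0 \<in> L0" "\<And>z. z \<in> S \<Longrightarrow> eval_poly g0 z = eval_poly g z"
      by blast
    have g0p: "g0 \<in> polys s"
      using g0(1) L0'(2) by blast
    have "poly_deg g \<le> poly_deg g0"
      by (rule min_deg_interp_space_le[OF L g0p g]) (rule g0(2)[symmetric])
    also have "\<dots> \<le> ereal (real b)"
      by (rule b[OF g0(1)])
    finally show ?thesis .
  qed
  then have "poly_deg g \<in> insert (-\<infinity>) ((\<lambda>d. ereal (real d)) ` {..b})" if "g \<in> L" for g
    using poly_deg_nonzero[of g] that by (cases "g = 0") (fastforce simp: poly_deg_def)+
  then have "poly_deg ` L \<subseteq> insert (-\<infinity>) ((\<lambda>d. ereal (real d)) ` {..b})"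
    by blast
  then have fin: "finite (poly_deg ` L)"
    by (rule finite_subset) simp
  obtain g where g: "g \<in> L" "\<And>z. z \<in> S \<Longrightarrow> eval_poly g z = eval_poly f z"
    using interp_space_obtain[OF Lint assms(2)] by blast
  have "poly_deg g \<le> interp_deg s S"
    unfolding interp_deg_def L_def[symmetric] using fin g(1) by (intro Max_ge) auto
  with g Lpol that show thesis
    by blast
qed

text \<open>Lagrange interpolation with one linear factor for each point of \<open>S\<close> other
  than \<open>z\<close>. The support condition makes distinct points differ in a coordinate among
  1..s, the only ones that \<open>polys s\<close> can see.\<close>

lemma indicator_poly:
  assumes "finite S" and S: "\<forall>y\<in>insert z S. \<forall>i. i \<notin> {1..s} \<longrightarrow> y i = 0"
  obtains f where "f \<in> polys s" "eval_poly f z = 1" "\<And>y. y \<in> S - {z} \<Longrightarrow> eval_poly f y = 0"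
proof -
  have "\<exists>i. i \<in> {1..s} \<and> y i \<noteq> z i" if y: "y \<in> S - {z}" for y
  proof (rule ccontr)
    assume *: "\<not> ?thesis"
    have "y i = z i" for i
      using * S y by (cases "i \<in> {1..s}") auto
    then show False
      using y by auto
  qed
  then obtain k where k: "\<And>y. y \<in> S - {z} \<Longrightarrow> k y \<in> {1..s} \<and> y (k y) \<noteq> z (k y)"
    by metis
  \<comment> \<open>With k = \<open>k y\<close> this is (\<xi>_k - y_k) / (z_k - y_k), equal to 1 at
    \<open>z\<close> and to 0 at \<open>y\<close>.\<close>
  define l :: "(nat \<Rightarrow> real) \<Rightarrow> rpoly" where
    "l y = Poly_Mapping.single (Poly_Mapping.single (k y) 1) (1 / (z (k y) - y (k y)))
       + Poly_Mapping.single 0 (- y (k y) / (z (k y) - y (k y)))" for y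
  have "l y \<in> polys s" if "y \<in> S - {z}" for y
    unfolding l_def using k[OF that]
    by (intro rpoly.subspace_add[OF subspace_polys] polys_single) auto
  moreover have "eval_poly (l y) z = 1" "eval_poly (l y) y = 0" if "y \<in> S - {z}" for y
    using k[OF that] by (auto simp: l_def eval_poly_add simp flip: diff_divide_distrib)
  ultimately show thesis
    using that[of "\<Prod>y\<in>S - {z}. l y"] assms(1)
    by (auto simp: eval_poly_prod intro!: polys_prod)
qed

section \<open>Orthogonal arrays from vanishing dual components\<close>

lemma sum_vec_prod:
  fixes f :: "'n::finite \<Rightarrow> 'x::finite \<Rightarrow> 'a::comm_semiring_1"
  shows "(\<Sum>z\<in>(UNIV :: ('x ^ 'n) set). \<Prod>l\<in>UNIV. f l (z $ l)) = (\<Prod>l\<in>UNIV. \<Sum>k\<in>UNIV. f l k)"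
proof -
  have "(\<Prod>l\<in>UNIV. \<Sum>k\<in>UNIV. f l k) = (\<Sum>g\<in>(UNIV :: ('n \<Rightarrow> 'x) set). \<Prod>l\<in>UNIV. f l (g l))"
    by (simp add: prod_sum_PiE)
  also have "\<dots> = (\<Sum>z\<in>(UNIV :: ('x ^ 'n) set). \<Prod>l\<in>UNIV. f l (z $ l))"
    by (rule sum.reindex_bij_witness[of _ vec_nth vec_lambda]) auto
  finally show ?thesis ..
qed

lemma tensor_mat_mult: "tensor_mat F ** tensor_mat G = tensor_mat (\<lambda>l. F l ** G l)"
proof -
  have "(\<Sum>z\<in>UNIV. \<Prod>l\<in>UNIV. F l $ (x $ l) $ (z $ l) * G l $ (z $ l) $ (y $ l)) =
      (\<Prod>l\<in>UNIV. \<Sum>k\<in>UNIV. F l $ (x $ l) $ k * G l $ k $ (y $ l))" for x y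
    by (rule sum_vec_prod)
  then show ?thesis
    by (simp add: vec_eq_iff matrix_matrix_mult_def tensor_mat_def flip: prod.distrib)
qed

lemma tensor_mat_eq_0: "F l = 0 \<Longrightarrow> tensor_mat F = 0"
  by (auto simp: tensor_mat_def vec_eq_iff intro!: exI[of _ l])

lemma matrix_mult_sum_right: "A ** (\<Sum>i\<in>I. B i) = (\<Sum>i\<in>I. A ** B i)"
  for A :: "complex ^ 'a::finite ^ 'b"
  by (induction I rule: infinite_finite_induct) (auto simp: matrix_add_ldistrib)

lemma matrix_vector_mult_sum: "(\<Sum>i\<in>I. B i) *v v = (\<Sum>i\<in>I. B i *v v)"
  for v :: "complex ^ 'a::finite"
  by (induction I rule: infinite_finite_induct) (auto simp: matrix_vector_mult_add_rdistrib)

section \<open>Idempotents of the Hamming scheme\<close>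

lemma base_idem_0: "base_idem 0 $ x $ y = 1 / of_nat CARD('x)" for x :: "'x::finite"
  by (simp add: base_idem_def cscale_def all_ones_def)

lemma base_idem_sum: "base_idem 0 + base_idem 1 = mat 1"
  by (simp add: base_idem_def Let_def)

lemma base_idem_0_0: "base_idem 0 ** base_idem 0 = (base_idem 0 :: complex ^ 'x ^ 'x::finite)"
  by (simp add: vec_eq_iff matrix_matrix_mult_def base_idem_0)

text \<open>Multiplying F_0 + F_1 = I by F_0 on either side gives orthogonality, since F_0 F_0 =
  F_0; multiplying it by F_1 then gives F_1 F_1 = F_1.\<close>

lemma base_idem_mult:
  assumes "i \<in> {0, 1}" "j \<in> {0, 1}"
  shows "base_idem i ** base_idem j = (if i = j then base_idem i else 0)"
proof -
  let ?F = "base_idem :: nat \<Rightarrow> complex ^ 'a ^ 'a"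
  have l: "?F 0 ** (?F 0 + ?F 1) = ?F 0 ** ?F 0 + ?F 0 ** ?F 1"
    "?F 1 ** (?F 0 + ?F 1) = ?F 1 ** ?F 0 + ?F 1 ** ?F 1"
    by (rule matrix_add_ldistrib)+
  have r: "(?F 0 + ?F 1) ** ?F 0 = ?F 0 ** ?F 0 + ?F 1 ** ?F 0"
    by (simp add: vec_eq_iff matrix_matrix_mult_def distrib_right sum.distrib)
  have "?F 0 ** ?F 1 = 0" "?F 1 ** ?F 0 = 0"
    using l(1) r unfolding base_idem_sum by (simp_all add: base_idem_0_0)
  moreover from this have "?F 1 ** ?F 1 = ?F 1"
    using l(2) unfolding base_idem_sum by simp
  ultimately show ?thesis
    using assms by (auto simp: base_idem_0_0)
qed

lemma finite_binary_weight:
  "finite {\<tau> :: 'n::finite \<Rightarrow> nat. (\<forall>l. \<tau> l \<in> {0, 1}) \<and> (\<Sum>l\<in>UNIV. \<tau> l) = i}"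
  by (rule finite_subset[of _ "PiE UNIV (\<lambda>_. {0, 1})"]) (simp_all add: subset_eq PiE_iff finite_PiE)

text \<open>Tensor products for distinct binary words annihilate each other, since a position where
  the words differ contributes a zero factor; only \<sigma> = \<tau> survives in the sum. Hence a
  vector killed by a Hamming idempotent is killed by each of its summands.\<close>

lemma tensor_base_idem_mult_hamming_idem:
  fixes \<tau> :: "'n::finite \<Rightarrow> nat"
  assumes \<tau>: "\<And>l. \<tau> l \<in> {0, 1}"
  shows "tensor_mat (\<lambda>l. base_idem (\<tau> l)) ** hamming_idem (\<Sum>l\<in>UNIV. \<tau> l)
    = (tensor_mat (\<lambda>l. base_idem (\<tau> l)) :: complex ^ ('x::finite ^ 'n) ^ ('x ^ 'n))"
proof -
  let ?T = "{\<sigma> :: 'n \<Rightarrow> nat. (\<forall>l. \<sigma> l \<in> {0, 1}) \<and> (\<Sum>l\<in>UNIV. \<sigma> l) = (\<Sum>l\<in>UNIV. \<tau> l)}"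
  let ?F = "\<lambda>\<sigma>. tensor_mat (\<lambda>l. base_idem (\<sigma> l)) :: complex ^ ('x ^ 'n) ^ ('x ^ 'n)"
  have "?F \<tau> ** ?F \<sigma> = (if \<sigma> = \<tau> then ?F \<tau> else 0)" if \<sigma>: "\<sigma> \<in> ?T" for \<sigma>
  proof (cases "\<sigma> = \<tau>")
    case False
    then obtain l where "\<tau> l \<noteq> \<sigma> l"
      by (metis ext)
    with \<tau> \<sigma> have "base_idem (\<tau> l) ** base_idem (\<sigma> l) = (0 :: complex ^ 'x ^ 'x)"
      by (subst base_idem_mult) auto
    with False show ?thesis
      by (simp add: tensor_mat_mult tensor_mat_eq_0[of _ l])
  qed (simp add: tensor_mat_mult base_idem_mult \<tau>[simplified])
  then have "(\<Sum>\<sigma>\<in>?T. ?F \<tau> ** ?F \<sigma>) = (\<Sum>\<sigma>\<in>?T. if \<sigma> = \<tau> then ?F \<tau> else 0)"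
    by (rule sum.cong[OF refl])
  also have "\<dots> = ?F \<tau>"
    using \<tau> by (subst sum.delta[OF finite_binary_weight]) simp
  finally show ?thesis
    by (simp add: hamming_idem_def matrix_mult_sum_right)
qed

section \<open>Averaging operators and orthogonal arrays\<close>

text \<open>The projection that averages a function over the coordinates outside \<open>D\<close>
  and leaves those in \<open>D\<close> alone. For empty \<open>D\<close> it is the mean over all
  words.\<close>

definition cylinder_mat :: "'n::finite set \<Rightarrow> complex ^ ('x::finite ^ 'n) ^ ('x ^ 'n)" where
  "cylinder_mat D = tensor_mat (\<lambda>l. if l \<in> D then mat 1 else base_idem 0)"

text \<open>Expand I = F_0 + F_1 at each position of \<open>D\<close>; the index words \<tau> are
  those supported in \<open>D\<close>.\<close>

lemma cylinder_mat_eq_sum: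
  "cylinder_mat D =
     (\<Sum>\<tau>\<in>PiE UNIV (\<lambda>l. if l \<in> D then {0, 1} else {0}). tensor_mat (\<lambda>l. base_idem (\<tau> l)))"
proof -
  let ?B = "\<lambda>l. if l \<in> D then {0, 1} else {0 :: nat}"
  have *: "(if l \<in> D then mat 1 else base_idem 0) = (\<Sum>k\<in>?B l. base_idem k)" for l
    by (simp add: base_idem_sum[symmetric])
  show ?thesis
    unfolding cylinder_mat_def *
    by (simp add: vec_eq_iff tensor_mat_def prod_sum_PiE)
qed

text \<open>A nonzero \<tau> supported in \<open>D\<close> has weight between 1 and
  \<open>card D\<close>, so its term is killed by the assumption. Only \<tau> = 0 remains, which is
  the total average.\<close>

lemma cylinder_mat_mult_eq:
  fixes v :: "complex ^ ('x::finite ^ 'n::finite)"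
  assumes zero: "\<And>i. 1 \<le> i \<Longrightarrow> i \<le> card D \<Longrightarrow> hamming_idem i *v v = 0"
  shows "cylinder_mat D *v v = cylinder_mat {} *v v"
proof -
  let ?P = "PiE UNIV (\<lambda>l. if l \<in> D then {0, 1} else {0 :: nat})"
  let ?F = "\<lambda>\<tau>. tensor_mat (\<lambda>l. base_idem (\<tau> l)) :: complex ^ ('x ^ 'n) ^ ('x ^ 'n)"
  have "?F \<tau> *v v = (if \<tau> = (\<lambda>_. 0) then cylinder_mat {} *v v else 0)" if \<tau>: "\<tau> \<in> ?P" for \<tau>
  proof (cases "\<tau> = (\<lambda>_. 0)")
    case False
    have bin: "\<tau> l \<in> {0, 1}" "l \<notin> D \<Longrightarrow> \<tau> l = 0" for l
      using \<tau> by (auto simp: PiE_iff split: if_splits)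
    obtain l where "\<tau> l \<noteq> 0"
      using False by auto
    then have "1 \<le> (\<Sum>l\<in>UNIV. \<tau> l)"
      using member_le_sum[of l UNIV \<tau>] by simp
    moreover have "(\<Sum>l\<in>UNIV. \<tau> l) = (\<Sum>l\<in>D. \<tau> l)"
      using bin by (intro sum.mono_neutral_right) auto
    then have "(\<Sum>l\<in>UNIV. \<tau> l) \<le> card D"
      using sum_bounded_above[of D \<tau> 1] bin by (force simp: le_Suc_eq)
    ultimately have "hamming_idem (\<Sum>l\<in>UNIV. \<tau> l) *v v = 0"
      by (rule zero)
    then have "?F \<tau> *v v = 0"
      by (metis bin(1) tensor_base_idem_mult_hamming_idem matrix_vector_mul_assoc
          matrix_vector_mult_0_right)
    with False show ?thesis
      by simp
  qed (simp add: cylinder_mat_def)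
  then have "(\<Sum>\<tau>\<in>?P. ?F \<tau> *v v) = (\<Sum>\<tau>\<in>?P. if \<tau> = (\<lambda>_. 0) then cylinder_mat {} *v v else 0)"
    by (rule sum.cong[OF refl])
  also have "\<dots> = cylinder_mat {} *v v"
  proof (subst sum.delta)
    show "finite ?P"
      by (rule finite_PiE) auto
  qed auto
  finally show ?thesis
    by (simp add: cylinder_mat_eq_sum[of D] matrix_vector_mult_sum)
qed

lemma matrix_mult_char_vec: "(A *v char_vec C) $ x = (\<Sum>y\<in>C. A $ x $ y)"
proof -
  have *: "char_vec C $ y = (if y \<in> C then 1 else 0)" for y
    by (simp add: char_vec_def axis_def if_distrib eq_commute[of _ y] cong: if_cong)
  show ?thesis
    by (simp add: matrix_vector_mult_def * if_distrib sum.If_cases cong: if_cong)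
qed

lemma cylinder_mat_nth:
  fixes x y :: "'x::finite ^ 'n::finite"
  shows "cylinder_mat D $ x $ y =
    (\<Prod>l\<in>UNIV. if l \<in> D then (if x $ l = y $ l then 1 else 0) else 1 / of_nat CARD('x))"
  by (auto simp: cylinder_mat_def tensor_mat_def base_idem_0 mat_def intro!: prod.cong)

definition depends_on :: "'n set \<Rightarrow> ('x ^ 'n \<Rightarrow> 'a) \<Rightarrow> bool" where
  "depends_on D g \<longleftrightarrow> (\<forall>x y. (\<forall>l\<in>D. x $ l = y $ l) \<longrightarrow> g x = g y)"

text \<open>The averaging matrix of \<open>D\<close> reproduces \<open>g\<close>. Moved onto the
  characteristic vector, it may be replaced by that of the empty set, which yields the constant |C|
  / |X|^n. This is the orthogonal array property on the coordinates in \<open>D\<close>.\<close>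

lemma code_sum_depends_on:
  fixes C :: "('x::finite ^ 'n::finite) set" and g :: "'x ^ 'n \<Rightarrow> real"
  assumes zero: "\<And>i. 1 \<le> i \<Longrightarrow> i \<le> card D \<Longrightarrow> hamming_idem i *v char_vec C = 0"
    and g: "depends_on D g"
  shows "(\<Sum>x\<in>C. g x) = card C / CARD('x) ^ CARD('n) * (\<Sum>x\<in>UNIV. g x)"
proof -
  let ?K = "cylinder_mat D :: complex ^ ('x ^ 'n) ^ ('x ^ 'n)"
  let ?g = "\<lambda>x. complex_of_real (g x)"
  \<comment> \<open>An entry is zero unless \<open>x\<close> and \<open>y\<close> agree on
    \<open>D\<close>, in which case \<open>g\<close> takes equal values; and each column sums to
    1.\<close>
  have "(\<Sum>x\<in>UNIV. ?K $ x $ y * ?g x) = ?g y" for y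
  proof -
    have "?K $ x $ y * ?g x = ?K $ x $ y * ?g y" for x
    proof (cases "\<forall>l\<in>D. x $ l = y $ l")
      case True
      with g show ?thesis
        unfolding depends_on_def by metis
    next
      case False
      then obtain l where "l \<in> D" "x $ l \<noteq> y $ l"
        by blast
      then have "?K $ x $ y = 0"
        by (auto simp: cylinder_mat_nth intro!: bexI[of _ l])
      then show ?thesis
        by simp
    qed
    then have "(\<Sum>x\<in>UNIV. ?K $ x $ y * ?g x) = (\<Sum>x\<in>UNIV. ?K $ x $ y * ?g y)"
      by (rule sum.cong[OF refl])
    also have "\<dots> = (\<Sum>x\<in>UNIV. ?K $ x $ y) * ?g y"
      by (simp add: sum_distrib_right)
    also have "(\<Sum>x\<in>UNIV. ?K $ x $ y) = 1"
    proof -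
      have "(\<Sum>x\<in>UNIV. ?K $ x $ y) = (\<Prod>l\<in>UNIV. \<Sum>k\<in>(UNIV :: 'x set).
          if l \<in> D then (if k = y $ l then 1 else 0) else 1 / of_nat CARD('x))"
        unfolding cylinder_mat_nth by (rule sum_vec_prod)
      also have "\<dots> = 1"
      proof (intro prod.neutral ballI)
        fix l
        show "(\<Sum>k\<in>(UNIV :: 'x set). if l \<in> D then (if k = y $ l then 1 else 0)
            else 1 / complex_of_nat CARD('x)) = 1"
          by (cases "l \<in> D") simp_all
      qed
      finally show ?thesis .
    qed
    finally show ?thesis
      by simp
  qed
  then have "(\<Sum>y\<in>C. ?g y) = (\<Sum>y\<in>C. \<Sum>x\<in>UNIV. ?K $ x $ y * ?g x)"
    by simp
  also have "\<dots> = (\<Sum>x\<in>UNIV. (?K *v char_vec C) $ x * ?g x)"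
    by (subst sum.swap) (simp add: matrix_mult_char_vec sum_distrib_right)
  also have "\<dots> = (\<Sum>x\<in>UNIV. (card C / CARD('x) ^ CARD('n)) * ?g x)"
  proof -
    have "?K *v char_vec C = cylinder_mat {} *v char_vec C"
      by (rule cylinder_mat_mult_eq) (rule zero)
    then have "(?K *v char_vec C) $ x = card C / CARD('x) ^ CARD('n)" for x
      by (simp only: matrix_mult_char_vec[of "cylinder_mat {}"] cylinder_mat_nth)
         (simp add: power_divide)
    then show ?thesis
      by simp
  qed
  also have "\<dots> = complex_of_real (card C / CARD('x) ^ CARD('n) * (\<Sum>x\<in>UNIV. g x))"
    by (simp add: sum_distrib_left)
  finally show ?thesis
    by (metis of_real_sum of_real_eq_iff)
qed

lemma hamming_idem_below_dual_distance:
  assumes "1 \<le> i" "i \<le> CARD('n)" "i < dual_distance C"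
  shows "hamming_idem i *v char_vec (C :: ('x::finite ^ 'n::finite) set) = 0"
proof (rule ccontr)
  assume "\<not> ?thesis"
  then have "dual_distance C \<le> i"
    unfolding dual_distance_def using assms by (intro Min_le) auto
  with assms show False
    by simp
qed

section \<open>Functions of bounded degree on words\<close>

text \<open>The functions of degree at most \<open>d\<close> on words: finite sums of functions of
  at most \<open>d\<close> coordinates each. Scalars are absorbed into the summands, so closure
  under addition suffices for linearity arguments.\<close>

inductive locality :: "nat \<Rightarrow> ('x ^ 'n::finite \<Rightarrow> real) \<Rightarrow> bool" for d where
  base: "depends_on D g \<Longrightarrow> card D \<le> d \<Longrightarrow> locality d g"
| add: "locality d g \<Longrightarrow> locality d h \<Longrightarrow> locality d (\<lambda>x. g x + h x)"

lemma locality_const: "locality d (\<lambda>_. c)"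
  by (rule locality.base[of "{}"]) (auto simp: depends_on_def)

lemma locality_sum: "(\<And>i. i \<in> I \<Longrightarrow> locality d (f i)) \<Longrightarrow> locality d (\<lambda>x. \<Sum>i\<in>I. f i x)"
  by (induction I rule: infinite_finite_induct) (auto intro: locality_const locality.add)

text \<open>For single summands the product depends on the union of their coordinate sets;
  distributivity and a nested induction do the rest.\<close>

lemma locality_mult:
  assumes "locality d g" "locality e h"
  shows "locality (d + e) (\<lambda>x. g x * h x)"
  using assms(1)
proof (induction)
  case (base D g)
  from assms(2) show ?case
  proof (induction)
    case (base E h)
    have "depends_on (D \<union> E) (\<lambda>x. g x * h x)"
      using \<open>depends_on D g\<close> \<open>depends_on E h\<close> unfolding depends_on_def by (metis UnI1 UnI2)
    moreover have "card (D \<union> E) \<le> d + e"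
      using card_Un_le[of D E] \<open>card D \<le> d\<close> \<open>card E \<le> e\<close> by linarith
    ultimately show ?case
      by (rule locality.base)
  next
    case (add h h')
    then show ?case
      by (simp add: distrib_left locality.add)
  qed
next
  case (add g g')
  then show ?case
    by (simp add: distrib_right locality.add)
qed

lemma locality_power: "locality 1 g \<Longrightarrow> locality k (\<lambda>x. g x ^ k)"
proof (induction k)
  case (Suc k)
  then show ?case
    using locality_mult[of 1 g k "\<lambda>x. g x ^ k"] by simp
qed (simp add: locality_const)

lemma locality_prod:
  "finite I \<Longrightarrow> (\<And>i. i \<in> I \<Longrightarrow> locality (d i) (f i)) \<Longrightarrow> locality (\<Sum>i\<in>I. d i) (\<lambda>x. \<Prod>i\<in>I. f i x)"
  by (induction I rule: finite_induct) (auto intro: locality_const locality_mult)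

text \<open>Both sides are additive in \<open>g\<close>, so it is enough to treat functions of at
  most \<open>d\<close> coordinates, to which the orthogonal array property applies.\<close>

lemma code_sum_locality:
  fixes C :: "('x::finite ^ 'n::finite) set"
  assumes "locality d g" "d < dual_distance C"
  shows "(\<Sum>x\<in>C. g x) = card C / CARD('x) ^ CARD('n) * (\<Sum>x\<in>UNIV. g x)"
  using assms(1)
proof (induction)
  case (base D g)
  \<comment> \<open>\<open>dual_distance\<close> only concerns indices up to n, so
    \<open>card D\<close> has to be bounded by n as well.\<close>
  have "card D \<le> CARD('n)"
    by (rule card_mono) auto
  with base assms(2) show ?case
    by (intro code_sum_depends_on hamming_idem_below_dual_distance) auto
next
  case (add g h)
  then show ?case
    by (simp add: sum.distrib distrib_left)
qed

section \<open>Designs from products over disjoint pairs\<close>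

definition pair_sign :: "('n \<times> 'n) list \<Rightarrow> 'n set \<Rightarrow> real" where
  "pair_sign ps S = (\<Prod>(a, b)\<leftarrow>ps. of_bool (a \<in> S) - of_bool (b \<in> S))"

definition points :: "('n \<times> 'n) list \<Rightarrow> 'n set" where
  "points ps = fst ` set ps \<union> snd ` set ps"

definition disjoint_pairs :: "('n \<times> 'n) list \<Rightarrow> bool" where
  "disjoint_pairs ps \<longleftrightarrow> distinct (map fst ps @ map snd ps)"

lemma pair_sign_Nil [simp]: "pair_sign [] S = 1"
  by (simp add: pair_sign_def)

lemma pair_sign_Cons [simp]:
  "pair_sign ((a, b) # ps) S = (of_bool (a \<in> S) - of_bool (b \<in> S)) * pair_sign ps S"
  by (simp add: pair_sign_def)

lemma points_Nil [simp]: "points [] = {}"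
  by (simp add: points_def)

lemma points_Cons [simp]: "points ((a, b) # ps) = insert a (insert b (points ps))"
  by (auto simp: points_def)

lemma finite_points [simp]: "finite (points ps)"
  by (simp add: points_def)

lemma disjoint_pairs_Nil [simp]: "disjoint_pairs []"
  by (simp add: disjoint_pairs_def)

lemma disjoint_pairs_Cons [simp]:
  "disjoint_pairs ((a, b) # ps) \<longleftrightarrow> a \<noteq> b \<and> a \<notin> points ps \<and> b \<notin> points ps \<and> disjoint_pairs ps"
  by (auto simp: disjoint_pairs_def points_def image_iff)

text \<open>A nonzero factor means that exactly one point of its pair lies in \<open>S\<close>, and
  the pairs are disjoint.\<close>

lemma card_Int_points:
  assumes "disjoint_pairs ps" "pair_sign ps S \<noteq> 0"
  shows "card (S \<inter> points ps) = length ps"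
  using assms
proof (induction ps)
  case (Cons p ps)
  obtain a b where p: "p = (a, b)"
    by (cases p)
  have "S \<inter> points (p # ps) = insert (if a \<in> S then a else b) (S \<inter> points ps)"
    using Cons.prems by (auto simp: p)
  then show ?case
    using Cons by (auto simp: p)
qed simp

text \<open>Complementation changes the sign of every factor.\<close>

lemma pair_sign_Compl_eq_0_iff: "pair_sign ps (- S) = 0 \<longleftrightarrow> pair_sign ps S = 0"
  by (induction ps) (auto simp: of_bool_def split: if_splits)

text \<open>Counting one point per pair in \<open>S\<close>, and likewise in its complement, gives
  the two bounds. They are the ones that delimit S_r in the theorem.\<close>

lemma pair_sign_nonzero_card:
  fixes S :: "'n::finite set"
  assumes "disjoint_pairs ps" "pair_sign ps S \<noteq> 0"
  shows "length ps \<le> card S" "card S + length ps \<le> CARD('n)"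
proof -
  have *: "length ps \<le> card A" if "pair_sign ps A \<noteq> 0" for A :: "'n set"
    using card_Int_points[OF assms(1) that] card_mono[of A "A \<inter> points ps"] by simp
  show "length ps \<le> card S"
    using * assms(2) .
  have "length ps \<le> card (- S)"
    using * assms(2) by (simp add: pair_sign_Compl_eq_0_iff)
  moreover have "card S \<le> CARD('n)"
    by (rule card_mono) auto
  ultimately show "card S + length ps \<le> CARD('n)"
    by (simp add: Compl_eq_Diff_UNIV card_Diff_subset)
qed

lemma pair_sign_cong:
  "(\<And>a. a \<in> points ps \<Longrightarrow> a \<in> S \<longleftrightarrow> a \<in> S') \<Longrightarrow> pair_sign ps S = pair_sign ps S'"
  by (induction ps) auto

text \<open>The exchange negates the factor of (a, b) and fixes the points of all other
  pairs.\<close>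

lemma pair_sign_transpose:
  assumes "disjoint_pairs ((a, b) # ps)"
  shows "pair_sign ((a, b) # ps) {l. Transposition.transpose a b l \<in> S} = - pair_sign ((a, b) # ps) S"
proof -
  have "pair_sign ps {l. Transposition.transpose a b l \<in> S} = pair_sign ps S"
    using assms by (intro pair_sign_cong) (auto simp: Transposition.transpose_def)
  then show ?thesis
    by simp
qed

text \<open>By the identity for one more pair \<open>(u, v)\<close>, the sum for \<open>insert u U\<close> does not depend on the
  point \<open>u\<close> off \<open>U\<close> and the pairs.  Summing it over \<open>u\<close> gives a multiple of the sum for \<open>U\<close>,
  since a block contributing to it contains exactly one point of each pair.\<close>

lemma sum_superset_pair_sign:
  fixes blk :: "'a \<Rightarrow> 'n::finite set"
  assumes blk: "\<And>x. x \<in> W \<Longrightarrow> card (blk x) = k"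
    and zero: "\<And>ps. ps \<noteq> [] \<Longrightarrow> length ps \<le> t \<Longrightarrow> disjoint_pairs ps \<Longrightarrow>
      (\<Sum>x\<in>W. pair_sign ps (blk x)) = 0"
    and "ps \<noteq> []" "length ps + card U \<le> t" "disjoint_pairs ps" "U \<inter> points ps = {}"
  shows "(\<Sum>x\<in>W. of_bool (U \<subseteq> blk x) * pair_sign ps (blk x)) = 0"
proof -
  have "finite U"
    by simp
  then show ?thesis
    using assms(3-)
  proof (induction U arbitrary: ps rule: finite_induct)
    case empty
    then show ?case
      using zero by simp
  next
    case (insert u U)
    define G where "G v = (\<Sum>x\<in>W. of_bool (insert v U \<subseteq> blk x) * pair_sign ps (blk x))" for v
    define Z where "Z = - (U \<union> points ps)"
    have u: "u \<in> Z"
      using insert by (auto simp: Z_def)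
    have "G v = G u" if v: "v \<in> Z" for v
    proof (cases "v = u")
      case False
      \<comment> \<open>Removing \<open>u\<close> from the set makes room for the additional pair:
        the number of pairs plus the size of the set stays the same.\<close>
      have "(\<Sum>x\<in>W. of_bool (U \<subseteq> blk x) * pair_sign ((u, v) # ps) (blk x)) = 0"
        using insert.prems insert.hyps u v False by (intro insert.IH) (auto simp: Z_def)
      moreover have "of_bool (U \<subseteq> blk x) * pair_sign ((u, v) # ps) (blk x) =
          of_bool (insert u U \<subseteq> blk x) * pair_sign ps (blk x)
          - of_bool (insert v U \<subseteq> blk x) * pair_sign ps (blk x)" for x
        by (simp add: of_bool_def algebra_simps)
      ultimately show ?thesis
        by (simp add: G_def sum_subtractf)
    qed simp
    then have "card Z * G u = (\<Sum>v\<in>Z. G v)"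
      by simp
    also have "\<dots> = (\<Sum>x\<in>W. \<Sum>v\<in>Z. of_bool (insert v U \<subseteq> blk x) * pair_sign ps (blk x))"
      unfolding G_def by (rule sum.swap)
    also have "\<dots> = (\<Sum>x\<in>W. (real k - card U - length ps) *
        (of_bool (U \<subseteq> blk x) * pair_sign ps (blk x)))"
    proof (rule sum.cong[OF refl])
      fix x assume "x \<in> W"
      show "(\<Sum>v\<in>Z. of_bool (insert v U \<subseteq> blk x) * pair_sign ps (blk x)) =
        (real k - card U - length ps) * (of_bool (U \<subseteq> blk x) * pair_sign ps (blk x))"
      proof (cases "U \<subseteq> blk x \<and> pair_sign ps (blk x) \<noteq> 0")
        case True
        \<comment> \<open>A contributing block consists of \<open>U\<close>, one point of each pair,
          and points of \<open>Z\<close>; its size \<open>k\<close> thus fixes the number of the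
          latter.\<close>
        have eq: "blk x = (blk x \<inter> Z) \<union> (U \<union> (blk x \<inter> points ps))"
          using True by (auto simp: Z_def)
        have "card (blk x) = card (blk x \<inter> Z) + card (U \<union> (blk x \<inter> points ps))"
          by (subst eq, rule card_Un_disjoint) (auto simp: Z_def)
        also have "card (U \<union> (blk x \<inter> points ps)) = card U + length ps"
          using True insert.prems by (subst card_Un_disjoint) (auto simp: card_Int_points)
        finally have "real (card (blk x \<inter> Z)) = real k - card U - length ps"
          using blk[OF \<open>x \<in> W\<close>] by simp
        moreover have "(\<Sum>v\<in>Z. of_bool (insert v U \<subseteq> blk x) * pair_sign ps (blk x)) =
            (\<Sum>v\<in>Z. of_bool (v \<in> blk x)) * pair_sign ps (blk x)"
          using True by (simp add: sum_distrib_right)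
        ultimately show ?thesis
          using True by (simp add: Int_commute sum.If_cases of_bool_def)
      qed auto
    qed
    also have "\<dots> = (real k - card U - length ps) *
        (\<Sum>x\<in>W. of_bool (U \<subseteq> blk x) * pair_sign ps (blk x))"
      by (rule sum_distrib_left[symmetric])
    also have "(\<Sum>x\<in>W. of_bool (U \<subseteq> blk x) * pair_sign ps (blk x)) = 0"
      using insert.prems insert.hyps by (intro insert.IH) auto
    finally have "card Z * G u = 0"
      by simp
    \<comment> \<open>\<open>u\<close> lies in \<open>Z\<close>, so this factor can be
      cancelled.\<close>
    moreover have "card Z \<noteq> 0"
      using u by auto
    ultimately show ?case
      by (simp add: G_def)
  qed
qed

section \<open>From exchanges to designs\<close>

text \<open>While the sets differ, replacing a point of \<open>T - T'\<close> by one of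
  \<open>T' - T\<close> keeps the size and shrinks \<open>T - T'\<close>, so finitely many exchanges
  lead from \<open>T\<close> to \<open>T'\<close>.\<close>

lemma exchange_invariant:
  fixes T T' :: "'n::finite set"
  assumes step: "\<And>a b U. a \<noteq> b \<Longrightarrow> a \<notin> U \<Longrightarrow> b \<notin> U \<Longrightarrow> Suc (card U) = t \<Longrightarrow>
      f (insert a U) = f (insert b U)"
    and "card T = t" "card T' = t"
  shows "f T = f T'"
  using assms(2)
proof (induction "card (T - T')" arbitrary: T rule: less_induct)
  case less
  show ?case
  proof (cases "T = T'")
    case False
    have "\<not> T \<subseteq> T'" "\<not> T' \<subseteq> T"
      using False less.prems assms(3) card_subset_eq[of T' T] card_subset_eq[of T T'] by auto
    then obtain a b where ab: "a \<in> T" "a \<notin> T'" "b \<in> T'" "b \<notin> T"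
      by blast
    have card: "Suc (card (T - {a})) = t"
      using ab less.prems by (metis card_Suc_Diff1 finite)
    define T1 where "T1 = insert b (T - {a})"
    have "f (insert a (T - {a})) = f (insert b (T - {a}))"
      using ab card by (intro step) auto
    then have "f T = f T1"
      using ab by (simp add: T1_def insert_absorb)
    also have "f T1 = f T'"
    proof (rule less.hyps)
      have "T1 - T' \<subset> T - T'"
        using ab by (auto simp: T1_def)
      then show "card (T1 - T') < card (T - T')"
        by (simp add: psubset_card_mono)
      show "card T1 = t"
        using ab card by (simp add: T1_def)
    qed
    finally show ?thesis .
  qed simp
qed

text \<open>For a set \<open>U\<close> of t - 1 points and a single pair (a, b), the vanishing
  signed sum is the difference between the numbers of blocks containing \<open>insert a U\<close>
  and \<open>insert b U\<close>. So the count is invariant under exchanges.\<close>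

lemma is_design_if_pair_sums_zero:
  fixes blk :: "'a \<Rightarrow> 'n::finite set"
  assumes "finite W" "1 \<le> t"
    and blk: "\<And>x. x \<in> W \<Longrightarrow> card (blk x) = k"
    and zero: "\<And>ps. ps \<noteq> [] \<Longrightarrow> length ps \<le> t \<Longrightarrow> disjoint_pairs ps \<Longrightarrow>
      (\<Sum>x\<in>W. pair_sign ps (blk x)) = 0"
  shows "is_design t k (image_mset blk (mset_set W))"
proof -
  define N where "N T = card {x \<in> W. T \<subseteq> blk x}" for T
  have N: "real (N T) = (\<Sum>x\<in>W. of_bool (T \<subseteq> blk x))" for T
    using assms(1) by (simp add: N_def of_bool_def sum.If_cases Int_def)
  have step: "N (insert a U) = N (insert b U)"
    if "a \<noteq> b" "a \<notin> U" "b \<notin> U" "Suc (card U) = t" for a b U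
  proof -
    have "(\<Sum>x\<in>W. of_bool (U \<subseteq> blk x) * pair_sign [(a, b)] (blk x)) = 0"
      using that by (intro sum_superset_pair_sign[OF blk zero]) auto
    moreover have "of_bool (U \<subseteq> blk x) * pair_sign [(a, b)] (blk x) =
        of_bool (insert a U \<subseteq> blk x) - of_bool (insert b U \<subseteq> blk x)" for x
      by (simp add: of_bool_def)
    ultimately have "real (N (insert a U)) = real (N (insert b U))"
      by (simp add: N sum_subtractf)
    then show ?thesis
      by simp
  qed
  have size: "size {#b \<in># image_mset blk (mset_set W). T \<subseteq> b#} = N T" for T
    using assms(1) by (simp add: N_def filter_mset_image_mset filter_mset_mset_set)
  have "N T = N T'" if "card T = t" "card T' = t" for T T'
    by (rule exchange_invariant[of t N]) (use step that in auto)
  then have "\<exists>m. \<forall>T :: 'n set. card T = t \<longrightarrow> N T = m"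
    by metis
  with assms(1) blk show ?thesis
    by (auto simp: is_design_def size)
qed

section \<open>Compositions and the code\<close>

lemma of_nat_composition:
  "real (composition s R x y i) = (if i \<in> {1..s} then \<Sum>l\<in>UNIV. of_bool ((x $ l, y $ l) \<in> R i) else 0)"
  by (simp add: composition_def of_bool_def sum.If_cases)

lemma locality_nth: "locality 1 (\<lambda>x. f (x $ l))"
  by (rule locality.base[of "{l}"]) (auto simp: depends_on_def)

text \<open>An entry of the composition is a sum of indicators of one coordinate each.\<close>

lemma locality_composition: "locality 1 (\<lambda>x. real (composition s R c x i))"
proof (cases "i \<in> {1..s}")
  case True
  have "locality 1 (\<lambda>x. of_bool ((c $ l, x $ l) \<in> R i))" for l
    by (rule locality_nth)
  then show ?thesis
    unfolding of_nat_composition if_P[OF True] by (rule locality_sum)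
next
  case False
  show ?thesis
    unfolding of_nat_composition if_not_P[OF False] by (rule locality_const)
qed

lemma locality_eval_mono:
  "locality (mono_deg m) (\<lambda>x. eval_mono m (\<lambda>i. real (composition s R c x i)))"
  unfolding eval_mono_def mono_deg_def
  by (intro locality_prod locality_power locality_composition) simp

text \<open>A factor involves two coordinates but is a difference of two functions of one
  coordinate. Its degree is therefore 1, which keeps the total at r instead of 2r.\<close>

lemma locality_pair_sign: "locality (length ps) (\<lambda>x. pair_sign ps (supp x0 x))"
proof (induction ps)
  case (Cons p ps)
  obtain a b where p: "p = (a, b)"
    by (cases p)
  have "locality 1 (\<lambda>x. of_bool (x $ a \<noteq> x0) + - of_bool (x $ b \<noteq> x0) :: real)"
    by (intro locality.add) (rule locality_nth)+
  from locality_mult[OF this Cons.IH] show ?case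
    by (simp add: p supp_def)
qed (simp add: locality_const)

text \<open>The base word is constant, so permuting the coordinates of \<open>x\<close> preserves
  the composition. Exchanging the first pair therefore turns the sum into its own negative.\<close>

lemma sum_composition_pair_sign_zero:
  assumes "ps \<noteq> []" "disjoint_pairs ps"
  shows "(\<Sum>x\<in>(UNIV :: ('x::finite ^ 'n::finite) set).
    f (composition s R (\<chi> l. x0) x) * pair_sign ps (supp x0 x)) = (0 :: real)"
proof -
  obtain a b qs where ps: "ps = (a, b) # qs"
    using assms(1) by (metis list.exhaust surj_pair)
  let ?tr = "Transposition.transpose a b"
  define swp :: "'x ^ 'n \<Rightarrow> 'x ^ 'n" where "swp x = (\<chi> l. x $ ?tr l)" for x
  define h where "h x = f (composition s R (\<chi> l. x0) x) * pair_sign ps (supp x0 x)" for x :: "'x ^ 'n"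
  have "composition s R (\<chi> l. x0) (swp x) = composition s R (\<chi> l. x0) x" for x
  proof -
    have "card {l. (x0, x $ ?tr l) \<in> R i} = card {l. (x0, x $ l) \<in> R i}" for i
      by (rule bij_betw_same_card[of ?tr], rule bij_betw_byWitness[of _ ?tr]) auto
    then show ?thesis
      by (simp add: composition_def swp_def fun_eq_iff)
  qed
  moreover have "pair_sign ps (supp x0 (swp x)) = - pair_sign ps (supp x0 x)" for x
  proof -
    have "supp x0 (swp x) = {l. ?tr l \<in> supp x0 x}"
      by (simp add: supp_def swp_def)
    then show ?thesis
      using pair_sign_transpose assms(2) unfolding ps by metis
  qed
  ultimately have "h (swp x) = - h x" for x
    by (simp add: h_def)
  moreover have "(\<Sum>x\<in>UNIV. h x) = (\<Sum>x\<in>UNIV. h (swp x))"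
    by (rule sum.reindex_bij_witness[of _ swp swp]) (auto simp: swp_def vec_eq_iff)
  ultimately have "(\<Sum>x\<in>UNIV. h x) = 0"
    by (simp add: sum_negf)
  then show ?thesis
    by (simp add: h_def)
qed

text \<open>Each monomial times the sign function has degree below the dual distance, so its sum
  over \<open>C\<close> is proportional to its sum over all words, which is 0.\<close>

lemma code_sum_poly_pair_sign_zero:
  fixes C :: "('x::finite ^ 'n::finite) set"
  assumes ps: "ps \<noteq> []" "disjoint_pairs ps"
    and deg: "\<And>m. m \<in> Poly_Mapping.keys p \<Longrightarrow> mono_deg m + length ps < dual_distance C"
  shows "(\<Sum>x\<in>C. eval_poly p (\<lambda>i. real (composition s R (\<chi> l. x0) x i)) *
    pair_sign ps (supp x0 x)) = 0"
proof -
  let ?c = "\<lambda>x i. real (composition s R (\<chi> l. x0) x i)"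
  have mono: "(\<Sum>x\<in>C. eval_mono m (?c x) * pair_sign ps (supp x0 x)) = 0"
    if "m \<in> Poly_Mapping.keys p" for m
    using code_sum_locality[OF locality_mult[OF locality_eval_mono locality_pair_sign] deg[OF that],
        of s R "\<chi> l. x0" x0]
      sum_composition_pair_sign_zero[OF ps, of "\<lambda>\<alpha>. eval_mono m (\<lambda>i. real (\<alpha> i))" s R x0]
    by simp
  have "(\<Sum>x\<in>C. eval_poly p (?c x) * pair_sign ps (supp x0 x)) =
      (\<Sum>x\<in>C. \<Sum>m\<in>Poly_Mapping.keys p. Poly_Mapping.lookup p m *
         (eval_mono m (?c x) * pair_sign ps (supp x0 x)))"
    by (simp add: eval_poly_alt sum_distrib_right mult.assoc)
  also have "\<dots> = (\<Sum>m\<in>Poly_Mapping.keys p. Poly_Mapping.lookup p m *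
         (\<Sum>x\<in>C. eval_mono m (?c x) * pair_sign ps (supp x0 x)))"
    by (subst sum.swap) (simp add: sum_distrib_left)
  also have "\<dots> = 0"
    by (simp add: mono)
  finally show ?thesis .
qed

section \<open>Supports and compositions of codewords\<close>

lemma dual_idem_mult_char_vec:
  "(dual_idem s R x0 \<alpha> *v char_vec C) $ x = of_bool (x \<in> words_of_comp s R x0 \<alpha> \<inter> C)"
  by (cases "x \<in> words_of_comp s R x0 \<alpha>") (simp_all add: matrix_mult_char_vec dual_idem_def)

lemma dual_idem_mult_char_vec_eq_0_iff:
  "dual_idem s R x0 \<alpha> *v char_vec C = 0 \<longleftrightarrow> words_of_comp s R x0 \<alpha> \<inter> C = {}"
  by (auto simp: vec_eq_iff dual_idem_mult_char_vec)

lemma composition_in_multi_indices: "composition s R x y \<in> multi_indices s"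
  by (auto simp: multi_indices_def composition_def)

text \<open>The adjacency matrices sum to the all-ones matrix, so the relations partition the pairs,
  and A_0 = I makes \<open>R 0\<close> the diagonal. A position with an entry other than
  \<open>x0\<close> is thus counted by exactly one index from 1 to s, any other position by
  none.\<close>

lemma weight_composition:
  assumes "comm_assoc_scheme s R"
  shows "weight s (composition s R (\<chi> l. x0) x) = card (supp x0 x)"
proof -
  have one: "(\<Sum>i\<le>s. of_bool ((a, b) \<in> R i)) = (1 :: real)" for a b
  proof -
    have "(\<Sum>i\<le>s. adj_mat (R i)) $ a $ b = all_ones $ a $ b"
      using assms by (simp add: comm_assoc_scheme_def)
    then have "complex_of_real (\<Sum>i\<le>s. of_bool ((a, b) \<in> R i)) = of_real 1"
      by (simp add: adj_mat_def all_ones_def of_bool_def if_distrib cong: if_cong)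
    then show ?thesis
      by (simp only: of_real_eq_iff)
  qed
  have diag: "(a, b) \<in> R 0 \<longleftrightarrow> a = b" for a b
  proof -
    have "adj_mat (R 0) $ a $ b = mat 1 $ a $ b"
      using assms by (simp add: comm_assoc_scheme_def)
    then show ?thesis
      by (simp add: adj_mat_def mat_def split: if_splits)
  qed
  have "(\<Sum>i=1..s. of_bool ((a, b) \<in> R i)) = (of_bool (b \<noteq> a) :: real)" for a b
  proof -
    have "{..s} = insert 0 {1..s}"
      by auto
    with one[of a b] show ?thesis
      by (auto simp: diag of_bool_def)
  qed
  moreover have "real (weight s (composition s R (\<chi> l. x0) x)) =
      (\<Sum>l\<in>UNIV. \<Sum>i=1..s. of_bool ((x0, x $ l) \<in> R i))"
    unfolding weight_def of_nat_sum by (subst sum.swap) (simp add: of_nat_composition)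
  ultimately have "real (weight s (composition s R (\<chi> l. x0) x)) = real (card (supp x0 x))"
    by (simp add: supp_def of_bool_def sum.If_cases)
  then show ?thesis
    by simp
qed

lemma real_composition_in_comp_set:
  fixes C :: "('x::finite ^ 'n::finite) set"
  assumes "comm_assoc_scheme s R" "x \<in> C" "r \<le> card (supp x0 x)" "card (supp x0 x) + r \<le> CARD('n)"
  shows "(\<lambda>i. real (composition s R (\<chi> l. x0) x i)) \<in> comp_set s R x0 C r"
  using assms
  by (auto simp: comp_set_def weight_composition composition_in_multi_indices words_of_comp_def
      dual_idem_mult_char_vec_eq_0_iff intro!: image_eqI[of _ _ "composition s R (\<chi> l. x0) x"])

text \<open>A nonzero component is witnessed by a codeword, so all members are compositions of
  words, of which there are finitely many.\<close>

lemma finite_comp_set: "finite (comp_set s R x0 (C :: ('x::finite ^ 'n::finite) set) r)"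
proof (rule finite_subset)
  show "comp_set s R x0 C r \<subseteq> range (\<lambda>x i. real (composition s R (\<chi> l. x0) (x :: 'x ^ 'n) i))"
    by (auto simp: comp_set_def dual_idem_mult_char_vec_eq_0_iff words_of_comp_def)
qed simp

lemma comp_set_zero: "y \<in> comp_set s R x0 C r \<Longrightarrow> i \<notin> {1..s} \<Longrightarrow> y i = 0"
  by (auto simp: comp_set_def multi_indices_def)

section \<open>Designs from codes of large dual distance\<close>

theorem theorem3p1:
  fixes s t :: nat
    and R :: "nat \<Rightarrow> ('x::finite \<times> 'x) set"
    and x0 :: 'x
    and C :: "('x ^ 'n::finite) set"
  assumes "comm_assoc_scheme s R"
    and "CARD('n) \<ge> 2"
    and "is_code C"
    and "1 \<le> t" and "t \<le> CARD('n)"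
    and "\<And>r. 1 \<le> r \<Longrightarrow> r \<le> t \<Longrightarrow>
           interp_deg s (comp_set s R x0 C r) < ereal (real (dual_distance C) - real r)"
  shows "\<forall>\<alpha> \<in> multi_indices s. weight s \<alpha> \<le> CARD('n) \<longrightarrow>
           is_design t (weight s \<alpha>)
             (image_mset (supp x0) (mset_set (words_of_comp s R x0 \<alpha> \<inter> C)))"
proof (intro ballI impI)
  fix \<alpha> assume \<alpha>: "\<alpha> \<in> multi_indices s"
  let ?comp = "\<lambda>x. composition s R (\<chi> l. x0) (x :: 'x ^ 'n)"
  let ?rcomp = "\<lambda>x i. real (?comp x i)"
  let ?z = "\<lambda>i. real (\<alpha> i)"
  show "is_design t (weight s \<alpha>) (image_mset (supp x0) (mset_set (words_of_comp s R x0 \<alpha> \<inter> C)))"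
  proof (rule is_design_if_pair_sums_zero)
    show "card (supp x0 x) = weight s \<alpha>" if "x \<in> words_of_comp s R x0 \<alpha> \<inter> C" for x
      using that weight_composition[OF assms(1), of x0 x] by (simp add: words_of_comp_def)
  next
    fix ps :: "('n \<times> 'n) list"
    assume ps: "ps \<noteq> []" "length ps \<le> t" "disjoint_pairs ps"
    let ?S = "comp_set s R x0 C (length ps)"
    let ?sgn = "\<lambda>x. pair_sign ps (supp x0 x)"
    \<comment> \<open>\<open>?z\<close> may lie outside \<open>?S\<close>; the polynomial
      \<open>f\<close> below then vanishes on all of \<open>?S\<close>.\<close>
    have "\<forall>y\<in>insert ?z ?S. \<forall>i. i \<notin> {1..s} \<longrightarrow> y i = 0"
      using comp_set_zero[of _ s R x0 C] \<alpha> by (auto simp: multi_indices_def)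
    from indicator_poly[OF finite_comp_set this]
    obtain f where f: "f \<in> polys s" "eval_poly f ?z = 1" "\<And>y. y \<in> ?S - {?z} \<Longrightarrow> eval_poly f y = 0"
      by blast
    \<comment> \<open>The degree of \<open>f\<close> is uncontrolled; \<open>p\<close> has the same
      values on \<open>?S\<close> and degree at most \<mu>(S_r), where r =
      \<open>length ps\<close>.\<close>
    from interpolation_interp_deg[OF finite_comp_set f(1)]
    obtain p where p: "\<And>y. y \<in> ?S \<Longrightarrow> eval_poly p y = eval_poly f y"
      and p_deg: "poly_deg p \<le> interp_deg s ?S"
      by blast
    have deg: "mono_deg m + length ps < dual_distance C" if "m \<in> Poly_Mapping.keys p" for m
    proof -
      have "ereal (real (mono_deg m)) \<le> interp_deg s ?S"
        using p_deg that unfolding poly_deg_le_iff by blast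
      \<comment> \<open>The subtraction is one of reals, so the bound turns into deg + r < \<delta>
        without truncation.\<close>
      also have "\<dots> < ereal (real (dual_distance C) - real (length ps))"
        using ps by (intro assms(6)) (auto simp: Suc_le_eq)
      finally show ?thesis
        by simp
    qed
    \<comment> \<open>Where the sign vanishes both sides are 0. Elsewhere the support has between r
      and n - r points, so the composition lies in \<open>?S\<close>, where \<open>p\<close> is the
      indicator of \<open>?z\<close>.\<close>
    have "eval_poly p (?rcomp x) * ?sgn x = (if x \<in> words_of_comp s R x0 \<alpha> then ?sgn x else 0)"
      if x: "x \<in> C" for x
    proof (cases "?sgn x = 0")
      case False
      then have S: "?rcomp x \<in> ?S"
        using x ps(3) by (intro real_composition_in_comp_set[OF assms(1)] pair_sign_nonzero_card)
      have "?rcomp x = ?z \<longleftrightarrow> x \<in> words_of_comp s R x0 \<alpha>"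
        by (simp add: words_of_comp_def fun_eq_iff)
      then have "eval_poly p (?rcomp x) = (if x \<in> words_of_comp s R x0 \<alpha> then 1 else 0)"
        using p[OF S] f(2) f(3)[of "?rcomp x"] S by auto
      then show ?thesis
        by simp
    qed simp
    then have "(\<Sum>x\<in>C. eval_poly p (?rcomp x) * ?sgn x) =
        (\<Sum>x\<in>C. if x \<in> words_of_comp s R x0 \<alpha> then ?sgn x else 0)"
      by (rule sum.cong[OF refl])
    also have "\<dots> = (\<Sum>x\<in>words_of_comp s R x0 \<alpha> \<inter> C. ?sgn x)"
      by (simp add: sum.If_cases Int_commute Int_def)
    finally show "(\<Sum>x\<in>words_of_comp s R x0 \<alpha> \<inter> C. ?sgn x) = 0"
      using code_sum_poly_pair_sign_zero[OF ps(1,3) deg] by simp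
  qed (use assms(4) in simp_all)
qed

end
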